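(* Let $D,s\in\mathbb{N}$ and let $F$ be a graph with $\Delta(F)\le D$ and $v(F)<s$. Suppose $G$ is a $(2s-2,D+2)$-expanding graph and $\phi\colon F\hookrightarrow G$ is a $(2s-2,D)$-good embedding. Then for every graph $F'$ with $v(F')\le s$ and $\Delta(F')\le D$ which can be obtained from $F$ by successively adding a new vertex of degree $1$, there exists a $(2s-2,D)$-good embedding $\phi'\colon F'\hookrightarrow G$ which extends $\phi$.
   Context: An embedding $\phi\colon F\hookrightarrow G$ is an injective map $V(F)\to V(G)$ mapping edges to edges; $\phi(F)$ denotes the image of $V(F)$ and $\phi^{-1}(v)$ the preimage of a vertex $v$. For $X\subseteq V(G)$, $\Gamma_G(X)=\bigcup_{x\in X}N_G(x)$ and $N_G(X)=\Gamma_G(X)\setminus X$. A graph $G$ is $(s,K)$-expanding if $|N_G(X)|\ge K|X|$ for every $X\subseteq V(G)$ with $|X|\le s$. Given a graph $F$ with $\Delta(F)\le D$, an embedding $\phi\colon F\hookrightarrow G$ is $(s,D)$-good if for every $X\subseteq V(G)$ with $|X|\le s$, $$|\Gamma_G(X)\setminus\phi(F)|\ge\sum_{v\in X}\big[D-\deg_F(\phi^{-1}(v))\big]+|\phi(F)\cap X|,$$ where $\deg_F(\phi^{-1}(v)):=0$ if $v$ is not in the image of $\phi$. *)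

theory Defs
  imports Main
begin

record 'a ugraph =
  verts :: "'a set"
  edges :: "'a set set"

text \<open>Graphs are finite, simple and undirected; the empty graph is allowed.\<close>

definition graph :: "'a ugraph \<Rightarrow> bool" where
  "graph G \<longleftrightarrow> finite (verts G) \<and> (\<forall>e\<in>edges G. e \<subseteq> verts G \<and> card e = 2)"

definition neighbours :: "'a ugraph \<Rightarrow> 'a \<Rightarrow> 'a set" where
  "neighbours G v = {u. {u, v} \<in> edges G}"

definition degree :: "'a ugraph \<Rightarrow> 'a \<Rightarrow> nat" where
  "degree G v = card (neighbours G v)"

text \<open>The maximum degree of the graph without vertices is \<open>0\<close>.\<close>

definition max_degree :: "'a ugraph \<Rightarrow> nat" where
  "max_degree G = Max (insert 0 (degree G ` verts G))"

text \<open>\<open>Gamma G X\<close> may meet \<open>X\<close>; \<open>ext_nbhd G X\<close> is the external neighbourhood \<open>N\<^sub>G(X)\<close>.\<close>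

definition Gamma :: "'a ugraph \<Rightarrow> 'a set \<Rightarrow> 'a set" where
  "Gamma G X = (\<Union>x\<in>X. neighbours G x)"

definition ext_nbhd :: "'a ugraph \<Rightarrow> 'a set \<Rightarrow> 'a set" where
  "ext_nbhd G X = Gamma G X - X"

definition expanding :: "nat \<Rightarrow> nat \<Rightarrow> 'a ugraph \<Rightarrow> bool" where
  "expanding s K G \<longleftrightarrow>
     (\<forall>X. X \<subseteq> verts G \<and> card X \<le> s \<longrightarrow> card (ext_nbhd G X) \<ge> K * card X)"

text \<open>Embeddings need not be induced, and only their values on \<open>verts F\<close> matter.\<close>

definition embedding :: "('a \<Rightarrow> 'b) \<Rightarrow> 'a ugraph \<Rightarrow> 'b ugraph \<Rightarrow> bool" where
  "embedding \<phi> F G \<longleftrightarrow>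
     inj_on \<phi> (verts F) \<and> \<phi> ` verts F \<subseteq> verts G \<and> (\<forall>e\<in>edges F. \<phi> ` e \<in> edges G)"

definition preimage_degree :: "('a \<Rightarrow> 'b) \<Rightarrow> 'a ugraph \<Rightarrow> 'b \<Rightarrow> nat" where
  "preimage_degree \<phi> F v =
     (if v \<in> \<phi> ` verts F then degree F (inv_into (verts F) \<phi> v) else 0)"

definition good_embedding ::
    "nat \<Rightarrow> nat \<Rightarrow> ('a \<Rightarrow> 'b) \<Rightarrow> 'a ugraph \<Rightarrow> 'b ugraph \<Rightarrow> bool" where
  "good_embedding s D \<phi> F G \<longleftrightarrow>
     embedding \<phi> F G \<and>
     (\<forall>X. X \<subseteq> verts G \<and> card X \<le> s \<longrightarrow>
        int (card (Gamma G X - \<phi> ` verts F)) \<ge>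
          (\<Sum>v\<in>X. int D - int (preimage_degree \<phi> F v)) + int (card (\<phi> ` verts F \<inter> X)))"

definition add_leaf :: "'a ugraph \<Rightarrow> 'a ugraph \<Rightarrow> bool" where
  "add_leaf F F' \<longleftrightarrow>
     (\<exists>u v. u \<in> verts F \<and> v \<notin> verts F \<and>
        F' = \<lparr>verts = insert v (verts F), edges = insert {u, v} (edges F)\<rparr>)"

end

theory Submission
  imports Defs
begin

text \<open>
  Call the difference of the two sides of the goodness inequality the slack of \<open>X\<close>. Mapping a new
  leaf at \<open>u\<close> to \<open>y\<close> changes the slack of \<open>X\<close> by \<open>[\<phi> u \<in> X] - [y \<in> \<Gamma>(X)]\<close>, so if \<open>y\<close> is a bad choice,
  it is a neighbour of some set of slack \<open>0\<close> avoiding \<open>\<phi> u\<close>. Expansion forces sets of slack \<open>0\<close> to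
  have at most \<open>v(F)/2\<close> elements, and submodularity of the slack then shows that they are
  closed under union. If every unused neighbour of \<open>\<phi> u\<close> were bad, they would therefore all be
  neighbours of a single small set of slack \<open>0\<close>, and adding \<open>\<phi> u\<close> to that set would produce a set
  of negative slack.
\<close>

section \<open>Slack of a vertex set and its submodularity\<close>

definition slack :: "nat \<Rightarrow> ('a \<Rightarrow> 'b) \<Rightarrow> 'a ugraph \<Rightarrow> 'b ugraph \<Rightarrow> 'b set \<Rightarrow> int" where
  "slack D \<phi> F G X = int (card (Gamma G X - \<phi> ` verts F))
     - (\<Sum>v\<in>X. int D - int (preimage_degree \<phi> F v)) - int (card (\<phi> ` verts F \<inter> X))"

lemma good_embedding_iff_slack:
  "good_embedding s D \<phi> F G \<longleftrightarrow>
     embedding \<phi> F G \<and> (\<forall>X. X \<subseteq> verts G \<and> card X \<le> s \<longrightarrow> 0 \<le> slack D \<phi> F G X)"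
  unfolding good_embedding_def slack_def by (simp add: algebra_simps)

lemma neighbours_subset_verts: "graph G \<Longrightarrow> neighbours G v \<subseteq> verts G"
  unfolding graph_def neighbours_def by auto

lemma Gamma_subset_verts: "graph G \<Longrightarrow> Gamma G X \<subseteq> verts G"
  unfolding Gamma_def by (intro UN_least neighbours_subset_verts)

lemma finite_Gamma: "graph G \<Longrightarrow> finite (Gamma G X)"
  by (meson Gamma_subset_verts finite_subset graph_def)

lemma finite_neighbours: "graph G \<Longrightarrow> finite (neighbours G v)"
  by (meson neighbours_subset_verts finite_subset graph_def)

lemma Gamma_insert: "Gamma G (insert x X) = neighbours G x \<union> Gamma G X"
  unfolding Gamma_def by auto

lemma degree_le_max_degree: "graph F \<Longrightarrow> v \<in> verts F \<Longrightarrow> degree F v \<le> max_degree F"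
  unfolding max_degree_def graph_def by simp

lemma preimage_degree_image:
  "inj_on \<phi> (verts F) \<Longrightarrow> v \<in> verts F \<Longrightarrow> preimage_degree \<phi> F (\<phi> v) = degree F v"
  unfolding preimage_degree_def by simp

lemma preimage_degree_outside: "y \<notin> \<phi> ` verts F \<Longrightarrow> preimage_degree \<phi> F y = 0"
  unfolding preimage_degree_def by simp

text \<open>\<open>Gamma\<close> sends unions to unions, but an intersection only into the
  intersection of the images, whence the inequality. The other two terms of the slack are
  modular.\<close>

lemma slack_submodular:
  fixes \<phi> :: "'a \<Rightarrow> 'b"
  assumes "graph G" "finite X" "finite Y"
  shows "slack D \<phi> F G (X \<union> Y) + slack D \<phi> F G (X \<inter> Y) \<le> slack D \<phi> F G X + slack D \<phi> F G Y"
proof -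
  let ?I = "\<phi> ` verts F"
  let ?N = "\<lambda>X. Gamma G X - ?I"
  have fin: "finite (?N Z)" for Z
    using finite_Gamma[OF assms(1)] by simp
  have "card (?N (X \<union> Y)) + card (?N (X \<inter> Y)) \<le> card (?N X \<union> ?N Y) + card (?N X \<inter> ?N Y)"
    using fin by (intro add_mono card_mono finite_UnI finite_Int) (auto simp: Gamma_def)
  also have "\<dots> = card (?N X) + card (?N Y)"
    using fin by (intro card_Un_Int[symmetric])
  finally have 1: "card (?N (X \<union> Y)) + card (?N (X \<inter> Y)) \<le> card (?N X) + card (?N Y)" .
  have "card (?I \<inter> X) + card (?I \<inter> Y) = card ((?I \<inter> X) \<union> (?I \<inter> Y)) + card ((?I \<inter> X) \<inter> (?I \<inter> Y))"
    using assms by (intro card_Un_Int) auto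
  moreover have "(?I \<inter> X) \<union> (?I \<inter> Y) = ?I \<inter> (X \<union> Y)" "(?I \<inter> X) \<inter> (?I \<inter> Y) = ?I \<inter> (X \<inter> Y)"
    by auto
  ultimately have 2: "card (?I \<inter> X) + card (?I \<inter> Y) = card (?I \<inter> (X \<union> Y)) + card (?I \<inter> (X \<inter> Y))"
    by simp
  have 3: "sum f (X \<union> Y) + sum f (X \<inter> Y) = sum f X + sum f Y" for f :: "'b \<Rightarrow> int"
    using assms by (intro sum.union_inter)
  show ?thesis
    using 1 2 3[of "\<lambda>v. int D - int (preimage_degree \<phi> F v)"] unfolding slack_def by linarith
qed

section \<open>Sets of slack 0 under expansion\<close>

text \<open>Let \<open>I\<close> be the image of \<phi>. At least
  \<open>(D + 2) * card X - card (I - X)\<close> neighbours of \<open>X\<close> avoid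
  \<open>I\<close>, whereas slack 0 allows at most \<open>D * card X + card (I \<inter> X)\<close>
  of them. Comparing the two leaves \<open>2 * card X \<le> card I\<close>.\<close>

lemma slack_zero_imp_small:
  assumes "graph F" "graph G" "expanding k (D + 2) G" "X \<subseteq> verts G" "card X \<le> k"
    and "slack D \<phi> F G X = 0"
  shows "2 * card X \<le> card (verts F)"
proof -
  let ?I = "\<phi> ` verts F"
  have fI: "finite ?I" and fX: "finite X"
    using assms(1,2,4) finite_subset by (auto simp: graph_def)
  have "(D + 2) * card X \<le> card (ext_nbhd G X)"
    using assms(3-5) unfolding expanding_def by blast
  also have "\<dots> \<le> card ((Gamma G X - ?I) \<union> (?I - X))"
    using finite_Gamma[OF assms(2)] fI unfolding ext_nbhd_def by (intro card_mono) auto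
  also have "\<dots> \<le> card (Gamma G X - ?I) + card (?I - X)"
    by (rule card_Un_le)
  finally have "(D + 2) * card X + card (?I \<inter> X) \<le> card (Gamma G X - ?I) + card ?I"
    using card_Int_Diff[OF fI, of X] by linarith
  moreover have "(\<Sum>v\<in>X. int D - int (preimage_degree \<phi> F v)) \<le> (\<Sum>v\<in>X. int D)"
    by (rule sum_mono) simp
  moreover have "card ?I \<le> card (verts F)"
    using assms(1) by (simp add: card_image_le graph_def)
  moreover have "card X * D + 2 * card X = (D + 2) * card X"
    by (simp add: algebra_simps)
  moreover have "(\<Sum>v\<in>X. int D) = int (card X * D)"
    by simp
  ultimately have "2 * card X + 2 * card (?I \<inter> X) \<le> card (verts F) + 2 * card (?I \<inter> X)"
    using assms(6) unfolding slack_def by linarith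
  then show ?thesis by simp
qed

text \<open>Two sets of slack 0 have together at most \<open>card (verts F)\<close> elements, so
  goodness covers both their union and their intersection. By submodularity these two nonnegative
  slacks sum to at most 0.\<close>

lemma slack_zero_Union:
  assumes "graph F" "graph G" "expanding k (D + 2) G" "card (verts F) \<le> k"
    and good: "good_embedding k D \<phi> F G"
    and "finite A" "\<And>X. X \<in> A \<Longrightarrow> X \<subseteq> verts G \<and> card X \<le> k \<and> slack D \<phi> F G X = 0"
  shows "slack D \<phi> F G (\<Union>A) = 0 \<and> 2 * card (\<Union>A) \<le> card (verts F)"
  using assms(6,7)
proof (induction A rule: finite_induct)
  case empty
  then show ?case by (simp add: slack_def Gamma_def)
next
  case (insert X A)
  let ?c = "slack D \<phi> F G"
  have X: "X \<subseteq> verts G" "card X \<le> k" "?c X = 0" and sub: "\<Union>A \<subseteq> verts G"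
    using insert.prems by auto
  have fin: "finite X" "finite (\<Union>A)"
    using X(1) sub assms(2) finite_subset by (auto simp: graph_def)
  have A: "?c (\<Union>A) = 0" "2 * card (\<Union>A) \<le> card (verts F)"
    using insert by auto
  have "2 * card X \<le> card (verts F)"
    using slack_zero_imp_small assms(1-3) X by blast
  then have le: "card (X \<union> \<Union>A) \<le> k" "card (X \<inter> \<Union>A) \<le> k"
    using A(2) assms(4) card_Un_le[of X "\<Union>A"] card_mono[OF fin(1), of "X \<inter> \<Union>A"] by auto
  then have "0 \<le> ?c (X \<union> \<Union>A)" "0 \<le> ?c (X \<inter> \<Union>A)"
    using good X(1) sub unfolding good_embedding_iff_slack by (auto simp: le_infI1)
  then have "?c (X \<union> \<Union>A) = 0"
    using slack_submodular[OF assms(2) fin, of D \<phi> F] X A by linarith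
  \<comment> \<open>Slack 0 improves the size bound of the union from \<open>k\<close> back to half
    of \<open>card (verts F)\<close>, so the induction can continue.\<close>
  then show ?case
    using slack_zero_imp_small[OF assms(1-3) _ le(1)] X(1) sub by auto
qed

section \<open>Effect of one new leaf on degrees and slack\<close>

context
  fixes F F' :: "'a ugraph" and u v :: 'a
  assumes F: "graph F" and u: "u \<in> verts F" and v: "v \<notin> verts F"
    and F': "F' = \<lparr>verts = insert v (verts F), edges = insert {u, v} (edges F)\<rparr>"
begin

lemma new_leaf_no_edge: "e \<in> edges F \<Longrightarrow> v \<notin> e"
  using F v unfolding graph_def by blast

lemma graph_new_leaf: "graph F'"
  using F u v unfolding F' graph_def by (auto simp: card_insert_if)

lemma degree_new_leaf:
  "degree F' w = (if w = v then 1 else if w = u then degree F u + 1 else degree F w)"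
proof -
  have uv: "u \<noteq> v" using u v by auto
  have "neighbours F v = {}" "v \<notin> neighbours F w"
    using new_leaf_no_edge unfolding neighbours_def by blast+
  moreover have "neighbours F' w =
      (if w = v then insert u (neighbours F v) else if w = u then insert v (neighbours F u) else neighbours F w)"
    using uv unfolding F' neighbours_def by (auto simp: doubleton_eq_iff)
  ultimately show ?thesis
    using finite_neighbours[OF F] unfolding degree_def by auto
qed

context
  fixes \<phi> :: "'a \<Rightarrow> 'b" and G :: "'b ugraph" and y :: 'b
  assumes inj: "inj_on \<phi> (verts F)" and y: "y \<notin> \<phi> ` verts F"
begin

lemma image_new_leaf: "\<phi>(v := y) ` verts F' = insert y (\<phi> ` verts F)"
  using v unfolding F' by auto

lemma inj_on_new_leaf: "inj_on (\<phi>(v := y)) (verts F')"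
  using inj y v unfolding F' by (auto simp: inj_on_def)

lemma embedding_new_leaf:
  assumes "embedding \<phi> F G" "graph G" "y \<in> neighbours G (\<phi> u)"
  shows "embedding (\<phi>(v := y)) F' G"
proof -
  have "\<phi>(v := y) ` e = \<phi> ` e" if "e \<in> edges F" for e
    using new_leaf_no_edge[OF that] by auto
  moreover have "\<phi>(v := y) ` {u, v} = {y, \<phi> u}"
    using u v by auto
  moreover have "{y, \<phi> u} \<in> edges G"
    using assms(3) unfolding neighbours_def by simp
  moreover have "y \<in> verts G"
    using neighbours_subset_verts[OF assms(2)] assms(3) by blast
  ultimately show ?thesis
    using assms(1) inj_on_new_leaf image_new_leaf unfolding embedding_def
    by (auto simp: F' simp del: fun_upd_apply)
qed

text \<open>Before the step \<open>y\<close> is outside the image and has the default value 0;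
  afterwards it is the image of a leaf. The other end of the new edge gains 1 as well.\<close>

lemma preimage_degree_new_leaf:
  "preimage_degree (\<phi>(v := y)) F' x = preimage_degree \<phi> F x + of_bool (x = y) + of_bool (x = \<phi> u)"
proof (cases "x \<in> insert y (\<phi> ` verts F)")
  case True
  then obtain w where w: "w \<in> verts F'" "x = (\<phi>(v := y)) w"
    using image_new_leaf by (metis imageE)
  have new: "preimage_degree (\<phi>(v := y)) F' x = degree F' w"
    unfolding w(2) by (rule preimage_degree_image[OF inj_on_new_leaf w(1)])
  show ?thesis
  proof (cases "w = v")
    case True
    then have "x = y" "x \<noteq> \<phi> u" using w y u by auto
    then show ?thesis
      using new True y by (simp add: degree_new_leaf preimage_degree_outside)
  next
    case False
    then have "w \<in> verts F" "x = \<phi> w" "x \<noteq> y" "x = \<phi> u \<longleftrightarrow> w = u"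
      using w y u inj by (auto simp: F' inj_on_def)
    then show ?thesis
      using new False inj u by (simp add: degree_new_leaf preimage_degree_image)
  qed
next
  case False
  then show ?thesis
    using image_new_leaf u by (auto simp: preimage_degree_def)
qed

lemma slack_new_leaf:
  assumes "graph G" "finite X"
  shows "slack D (\<phi>(v := y)) F' G X
    = slack D \<phi> F G X - of_bool (y \<in> Gamma G X) + of_bool (\<phi> u \<in> X)"
proof -
  let ?I = "\<phi> ` verts F"
  have "Gamma G X - insert y ?I = (Gamma G X - ?I) - {y}"
    by auto
  then have 1: "int (card (Gamma G X - insert y ?I)) = int (card (Gamma G X - ?I)) - of_bool (y \<in> Gamma G X)"
    using card_Suc_Diff1[of "Gamma G X - ?I" y] finite_Gamma[OF assms(1), of X] y by auto
  have "(\<Sum>x\<in>X. int D - int (preimage_degree (\<phi>(v := y)) F' x))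
      = (\<Sum>x\<in>X. (int D - int (preimage_degree \<phi> F x)) - (of_bool (x = y) + of_bool (x = \<phi> u)))"
    by (intro sum.cong) (auto simp: preimage_degree_new_leaf simp del: fun_upd_apply)
  also have "\<dots> = (\<Sum>x\<in>X. int D - int (preimage_degree \<phi> F x)) - (of_bool (y \<in> X) + of_bool (\<phi> u \<in> X))"
    using assms(2) by (simp add: sum_subtractf sum.distrib of_bool_def)
  finally have 2: "(\<Sum>x\<in>X. int D - int (preimage_degree (\<phi>(v := y)) F' x)) = \<dots>" .
  have 3: "int (card (insert y ?I \<inter> X)) = int (card (?I \<inter> X)) + of_bool (y \<in> X)"
    using assms(2) y by (auto simp: Int_insert_left)
  show ?thesis
    unfolding slack_def image_new_leaf 1 2 3 by simp
qed

end

section \<open>Choosing the image of the leaf, and iteration\<close>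

lemma good_embedding_new_leaf:
  assumes G: "graph G" "expanding k (D + 2) G" and D: "max_degree F \<le> D"
    and k: "card (verts F) \<le> k" and good: "good_embedding k D \<phi> F G"
  shows "\<exists>y. good_embedding k D (\<phi>(v := y)) F' G"
proof (rule ccontr)
  assume none: "\<not> ?thesis"
  let ?c = "slack D \<phi> F G" and ?Y = "neighbours G (\<phi> u) - \<phi> ` verts F"
  have emb: "embedding \<phi> F G" and inj: "inj_on \<phi> (verts F)" and u': "\<phi> u \<in> verts G"
    using good u unfolding good_embedding_def embedding_def by auto
  have "\<exists>X. X \<subseteq> verts G \<and> card X \<le> k \<and> ?c X = 0 \<and> y \<in> Gamma G X \<and> \<phi> u \<notin> X" if "y \<in> ?Y" for y
  proof -
    have y: "y \<notin> \<phi> ` verts F" "y \<in> neighbours G (\<phi> u)"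
      using that by auto
    obtain X where X: "X \<subseteq> verts G" "card X \<le> k" "slack D (\<phi>(v := y)) F' G X < 0"
      using none embedding_new_leaf[OF inj y(1) emb G(1) y(2)]
      unfolding good_embedding_iff_slack by (auto simp: not_le)
    have "finite X"
      using X(1) G(1) finite_subset by (auto simp: graph_def)
    moreover have "0 \<le> ?c X"
      using good X unfolding good_embedding_iff_slack by blast
    \<comment> \<open>A slack drops by at most 1, so becoming negative requires the value 0 before,
      a loss from \<open>y\<close>, and no gain from \<open>\<phi> u\<close>.\<close>
    ultimately have "?c X = 0 \<and> y \<in> Gamma G X \<and> \<phi> u \<notin> X"
      using X(3) slack_new_leaf[OF inj y(1) G(1), of X D] by (auto simp: of_bool_def split: if_splits)
    with X show ?thesis by blast
  qed
  then obtain B where B: "\<And>y. y \<in> ?Y \<Longrightarrow>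
      B y \<subseteq> verts G \<and> card (B y) \<le> k \<and> ?c (B y) = 0 \<and> y \<in> Gamma G (B y) \<and> \<phi> u \<notin> B y"
    by metis
  define X where "X = \<Union>(B ` ?Y)"
  have X: "?c X = 0" "2 * card X \<le> card (verts F)"
    using slack_zero_Union[OF F G k good, of "B ` ?Y"] B finite_neighbours[OF G(1)]
    unfolding X_def by auto
  have sub: "X \<subseteq> verts G" and notin: "\<phi> u \<notin> X"
    using B unfolding X_def by auto
  have fin: "finite X"
    using sub G(1) finite_subset by (auto simp: graph_def)
  have "?Y \<subseteq> (\<Union>y\<in>?Y. Gamma G (B y))"
    using B by blast
  also have "\<dots> = Gamma G X"
    unfolding X_def Gamma_def by simp
  finally have "?Y \<subseteq> Gamma G X" .
  then have "Gamma G (insert (\<phi> u) X) - \<phi> ` verts F = Gamma G X - \<phi> ` verts F"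
    unfolding Gamma_insert by blast
  moreover have "\<phi> ` verts F \<inter> insert (\<phi> u) X = insert (\<phi> u) (\<phi> ` verts F \<inter> X)"
    using u by auto
  ultimately have "?c (insert (\<phi> u) X) = ?c X - (int D - int (degree F u)) - 1"
    using fin notin u inj unfolding slack_def by (simp add: preimage_degree_image)
  then have "?c (insert (\<phi> u) X) < 0"
    using X(1) degree_le_max_degree[OF F u] D by simp
  \<comment> \<open>For \<open>n \<ge> 1\<close>, half of \<open>n\<close> rounded down plus 1 is at
    most \<open>n\<close>; hence the enlarged set still has at most
    \<open>card (verts F) \<le> k\<close> elements.\<close>
  moreover have "card (verts F) > 0"
    using F u by (auto simp: card_gt_0_iff graph_def)
  then have "card (insert (\<phi> u) X) \<le> k"
    using X(2) k fin notin by simp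
  moreover have "insert (\<phi> u) X \<subseteq> verts G"
    using sub u' by simp
  ultimately show False
    using good unfolding good_embedding_iff_slack by (meson not_le)
qed

text \<open>Passes the degree bound from the final graph down to every intermediate graph.\<close>

lemma max_degree_new_leaf: "max_degree F \<le> max_degree F'"
proof -
  have "degree F w \<le> max_degree F'" if "w \<in> verts F" for w
  proof -
    have "degree F w \<le> degree F' w"
      using that v by (auto simp: degree_new_leaf)
    also have "\<dots> \<le> max_degree F'"
      using that by (intro degree_le_max_degree[OF graph_new_leaf]) (simp add: F')
    finally show ?thesis .
  qed
  then show ?thesis
    using F unfolding max_degree_def[of F] by (simp add: graph_def)
qed

end

text \<open>The bound is \<open>k + 1\<close> because only the graph before the last leaf must have
  at most \<open>k\<close> vertices.\<close>

lemma good_embedding_extend: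
  assumes "add_leaf\<^sup>*\<^sup>* F F'" "graph F" "graph G" "expanding k (D + 2) G" "good_embedding k D \<phi> F G"
    and "max_degree F' \<le> D" "card (verts F') \<le> k + 1"
  shows "\<exists>\<phi>'. good_embedding k D \<phi>' F' G \<and> (\<forall>v\<in>verts F. \<phi>' v = \<phi> v)"
proof -
  \<comment> \<open>The bounds are premises inside the induction claim, since they descend from the
    larger graph to the smaller one.\<close>
  have "graph F' \<and> verts F \<subseteq> verts F' \<and> (max_degree F' \<le> D \<longrightarrow> card (verts F') \<le> k + 1 \<longrightarrow>
      (\<exists>\<phi>'. good_embedding k D \<phi>' F' G \<and> (\<forall>v\<in>verts F. \<phi>' v = \<phi> v)))"
    using assms(1)
  proof (induction rule: rtranclp_induct)
    case base
    then show ?case using assms by blast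
  next
    case (step F1 F2)
    then have F1: "graph F1" "verts F \<subseteq> verts F1" by auto
    obtain u v where uv: "u \<in> verts F1" "v \<notin> verts F1"
      and F2: "F2 = \<lparr>verts = insert v (verts F1), edges = insert {u, v} (edges F1)\<rparr>"
      using step.hyps(2) unfolding add_leaf_def by blast
    have "\<exists>\<phi>'. good_embedding k D \<phi>' F2 G \<and> (\<forall>v\<in>verts F. \<phi>' v = \<phi> v)"
      if le: "max_degree F2 \<le> D" "card (verts F2) \<le> k + 1"
    proof -
      have D: "max_degree F1 \<le> D" and k: "card (verts F1) \<le> k"
        using le max_degree_new_leaf[OF F1(1) uv F2] F1(1) uv by (auto simp: F2 graph_def)
      then obtain \<phi>1 where good: "good_embedding k D \<phi>1 F1 G" and ext: "\<forall>v\<in>verts F. \<phi>1 v = \<phi> v"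
        using step.IH by auto
      obtain y where "good_embedding k D (\<phi>1(v := y)) F2 G"
        using good_embedding_new_leaf[OF F1(1) uv F2 assms(3,4) D k good] by blast
      moreover have "\<forall>w\<in>verts F. (\<phi>1(v := y)) w = \<phi> w"
        using ext F1(2) uv(2) by auto
      ultimately show ?thesis by blast
    qed
    moreover have "verts F \<subseteq> verts F2"
      using F1(2) by (auto simp: F2)
    ultimately show ?case
      using graph_new_leaf[OF F1(1) uv F2] by blast
  qed
  then show ?thesis using assms(6,7) by blast
qed

theorem theorem2p3:
  fixes D s :: nat
    and F :: "'a ugraph" and G :: "'b ugraph" and \<phi> :: "'a \<Rightarrow> 'b"
  assumes "graph F" and "max_degree F \<le> D" and "card (verts F) < s"
    and "graph G" and "expanding (2 * s - 2) (D + 2) G"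
    and "good_embedding (2 * s - 2) D \<phi> F G"
  shows "\<forall>F'. graph F' \<and> card (verts F') \<le> s \<and> max_degree F' \<le> D \<and> add_leaf\<^sup>*\<^sup>* F F' \<longrightarrow>
           (\<exists>\<phi>'. good_embedding (2 * s - 2) D \<phi>' F' G \<and> (\<forall>v\<in>verts F. \<phi>' v = \<phi> v))"
proof (intro allI impI, elim conjE)
  fix F' :: "'a ugraph"
  assume F': "card (verts F') \<le> s" "max_degree F' \<le> D" "add_leaf\<^sup>*\<^sup>* F F'"
  \<comment> \<open>As \<open>s\<close> is positive, the right-hand side is
    \<open>2 * s - 1\<close>, which is at least \<open>s\<close>.\<close>
  then have "card (verts F') \<le> 2 * s - 2 + 1"
    using assms(3) by linarith
  then show "\<exists>\<phi>'. good_embedding (2 * s - 2) D \<phi>' F' G \<and> (\<forall>v\<in>verts F. \<phi>' v = \<phi> v)"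
    using good_embedding_extend[OF F'(3) assms(1,4-6) F'(2)] by blast
qed

end
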